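(* Let $q=p^r>3$ be a prime power ($p$ prime) with $q\equiv 3 \pmod 4$, let $\mathbb{F}_q$ be the finite field of order $q$, and let $\mathbb{F}_q^{\times 2}$ be the group of nonzero squares in $\mathbb{F}_q$. Let $G$ be the group (under composition) of all affine transformations $x\mapsto ax+b$ of $\mathbb{F}_q$ with $a\in\mathbb{F}_q^{\times 2}$ and $b\in\mathbb{F}_q$, so that $G=H\rtimes K$, where $H$ is the group of translations $\tau_b(x)=x+b$ ($b\in\mathbb{F}_q$) and $K$ is the group of dilations $\theta_a(x)=ax$ ($a\in\mathbb{F}_q^{\times2}$). Let $\alpha_1\in\hat H$ be the character $\alpha_1(\tau_c)=\omega^{\operatorname{tr}(c)}$, where $\omega=\exp(2\pi i/p)$ and $\operatorname{tr}\colon\mathbb{F}_q\to\mathbb{F}_p$ is the field trace. Let $f\in L^2(K)$ be the constant function $f(\theta_a)\equiv\sqrt{2/(q-1)}$. Then the projective reduction of $\Phi=\{(\operatorname{ind}_H^G\alpha_1)(x)f\}_{x\in G}$ is an equiangular tight frame of $q$ vectors in $L^2(K)$, a space of dimension $(q-1)/2$.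
   Context: $L^2(K)$ is the space of complex functions on $K$ with inner product $\langle f,g\rangle=\sum_{y\in K}f(y)\overline{g(y)}$. For $G=H\rtimes K$ with $H$ abelian and $\alpha$ in the character group $\hat H$, the induced representation $\operatorname{ind}_H^G\alpha$ is realized on $L^2(K)$ by $$[(\operatorname{ind}_H^G\alpha)(hx)f](y)=\alpha(y^{-1}hy)\,f(x^{-1}y)\qquad(h\in H,\ x,y\in K,\ f\in L^2(K)).$$ Given a finite sequence $\Phi$ of unit vectors, a projective reduction of $\Phi$ is a subsequence $\Phi'$ such that every line spanned by a member of $\Phi$ is spanned by exactly one member of $\Phi'$. A projective reduction is not unique, but any two projective reductions of $\Phi$ are equiangular (resp. tight) at the same time; "the projective reduction" means any one of them. A sequence $\{f_j\}_{j\in I}$ in a Hilbert space $\mathcal{H}$ is a frame if there are $A,B>0$ with $A\|g\|^2\le\sum_{j\in I}|\langle g,f_j\rangle|^2\le B\|g\|^2$ for all $g\in\mathcal{H}$, and a tight frame if one can take $A=B$. It is equiangular if there is a constant $C$ such that $|\langle f_i,f_j\rangle|=1$ when $i=j$ and $|\langle f_i,f_j\rangle|=C$ otherwise. An equiangular tight frame is a tight frame that is equiangular. *)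

theory Defs
  imports
    "HOL-Algebra.Coset"
    "HOL-Computational_Algebra.Polynomial"
    "HOL-Library.Cardinality"
    "HOL-Library.Function_Algebras"
    "HOL-Number_Theory.Residues"
    Complex_Main
begin

section \<open>The space of complex functions on a finite set\<close>

text \<open>
  The elements of \<open>L2 K\<close> are represented by total functions that vanish outside \<open>K\<close>, so that
  \<open>L2 K\<close> is a linear subspace for the pointwise operations.
\<close>

definition L2 :: "'k set \<Rightarrow> ('k \<Rightarrow> complex) set"
  where "L2 K = {f. \<forall>y. y \<notin> K \<longrightarrow> f y = 0}"

definition fun_scale :: "complex \<Rightarrow> ('k \<Rightarrow> complex) \<Rightarrow> 'k \<Rightarrow> complex"
  where "fun_scale c f = (\<lambda>y. c * f y)"

global_interpretation cfun: vector_space "fun_scale :: complex \<Rightarrow> ('k \<Rightarrow> complex) \<Rightarrow> 'k \<Rightarrow> complex"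
  by unfold_locales (auto simp: fun_scale_def algebra_simps fun_eq_iff)

lemma subspace_L2: "cfun.subspace (L2 K)"
  by (auto simp: cfun.subspace_def L2_def fun_scale_def)

definition l2_inner :: "'k set \<Rightarrow> ('k \<Rightarrow> complex) \<Rightarrow> ('k \<Rightarrow> complex) \<Rightarrow> complex"
  where "l2_inner K f g = (\<Sum>y\<in>K. f y * cnj (g y))"

definition l2_norm :: "'k set \<Rightarrow> ('k \<Rightarrow> complex) \<Rightarrow> real"
  where "l2_norm K f = sqrt (Re (l2_inner K f f))"


section \<open>Finite frames\<close>

text \<open>A finite sequence is given by a finite index set \<open>I\<close> and a family \<open>\<Phi>\<close>; repetitions are allowed.\<close>

definition frame_with_bounds ::
    "'k set \<Rightarrow> 'i set \<Rightarrow> ('i \<Rightarrow> 'k \<Rightarrow> complex) \<Rightarrow> real \<Rightarrow> real \<Rightarrow> bool"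
  where "frame_with_bounds K I \<Phi> A B \<longleftrightarrow>
    finite I \<and> (\<forall>j\<in>I. \<Phi> j \<in> L2 K) \<and> A > 0 \<and> B > 0 \<and>
    (\<forall>g\<in>L2 K. A * (l2_norm K g)\<^sup>2 \<le> (\<Sum>j\<in>I. (cmod (l2_inner K g (\<Phi> j)))\<^sup>2) \<and>
               (\<Sum>j\<in>I. (cmod (l2_inner K g (\<Phi> j)))\<^sup>2) \<le> B * (l2_norm K g)\<^sup>2)"

definition tight_frame :: "'k set \<Rightarrow> 'i set \<Rightarrow> ('i \<Rightarrow> 'k \<Rightarrow> complex) \<Rightarrow> bool"
  where "tight_frame K I \<Phi> \<longleftrightarrow> (\<exists>A. frame_with_bounds K I \<Phi> A A)"

definition equiangular :: "'k set \<Rightarrow> 'i set \<Rightarrow> ('i \<Rightarrow> 'k \<Rightarrow> complex) \<Rightarrow> bool"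
  where "equiangular K I \<Phi> \<longleftrightarrow>
    (\<exists>C::real. \<forall>i\<in>I. \<forall>j\<in>I. cmod (l2_inner K (\<Phi> i) (\<Phi> j)) = (if i = j then 1 else C))"

definition equiangular_tight_frame :: "'k set \<Rightarrow> 'i set \<Rightarrow> ('i \<Rightarrow> 'k \<Rightarrow> complex) \<Rightarrow> bool"
  where "equiangular_tight_frame K I \<Phi> \<longleftrightarrow> tight_frame K I \<Phi> \<and> equiangular K I \<Phi>"

text \<open>\<open>J\<close> is the index set of the subsequence.\<close>

definition projective_reduction ::
    "'i set \<Rightarrow> ('i \<Rightarrow> 'k \<Rightarrow> complex) \<Rightarrow> 'i set \<Rightarrow> bool"
  where "projective_reduction I \<Phi> J \<longleftrightarrow>
    J \<subseteq> I \<and> (\<forall>i\<in>I. \<exists>!j. j \<in> J \<and> cfun.span {\<Phi> j} = cfun.span {\<Phi> i})"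

lemma projective_reduction_exists: "\<exists>J. projective_reduction I \<Phi> J"
proof -
  define L where "L = (\<lambda>i. cfun.span {\<Phi> i})"
  define s where "s = (\<lambda>i. SOME j. j \<in> I \<and> L j = L i)"
  have s: "s i \<in> I \<and> L (s i) = L i" if "i \<in> I" for i
    unfolding s_def by (rule someI[of _ i]) (use that in simp)
  have s_eq: "s i = s j" if "L i = L j" for i j
    using that by (simp add: s_def)
  have "projective_reduction I \<Phi> (s ` I)"
    unfolding projective_reduction_def L_def[symmetric]
  proof (intro conjI ballI)
    show "s ` I \<subseteq> I" using s by auto
    fix i assume i: "i \<in> I"
    show "\<exists>!j. j \<in> s ` I \<and> cfun.span {\<Phi> j} = cfun.span {\<Phi> i}"
    proof (rule ex1I[of _ "s i"])
      show "s i \<in> s ` I \<and> cfun.span {\<Phi> (s i)} = cfun.span {\<Phi> i}"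
        using s[OF i] i by (simp add: L_def)
    next
      fix j assume j: "j \<in> s ` I \<and> cfun.span {\<Phi> j} = cfun.span {\<Phi> i}"
      then obtain k where k: "k \<in> I" "j = s k" by auto
      with j have "L k = L i" using s[OF k(1)] by (simp add: L_def)
      thus "j = s i" unfolding k(2) by (rule s_eq)
    qed
  qed
  thus ?thesis by blast
qed


section \<open>Induced representations of semidirect products\<close>

definition semidirect :: "('g, 'b) monoid_scheme \<Rightarrow> 'g set \<Rightarrow> 'g set \<Rightarrow> bool"
  where "semidirect G H K \<longleftrightarrow>
    H \<lhd> G \<and> subgroup K G \<and> H \<inter> K = {\<one>\<^bsub>G\<^esub>} \<and> H <#>\<^bsub>G\<^esub> K = carrier G"

definition character :: "('g, 'b) monoid_scheme \<Rightarrow> 'g set \<Rightarrow> ('g \<Rightarrow> complex) \<Rightarrow> bool"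
  where "character G H \<alpha> \<longleftrightarrow>
    (\<forall>h\<in>H. cmod (\<alpha> h) = 1) \<and> (\<forall>h\<in>H. \<forall>h'\<in>H. \<alpha> (h \<otimes>\<^bsub>G\<^esub> h') = \<alpha> h * \<alpha> h')"

definition decompose :: "('g, 'b) monoid_scheme \<Rightarrow> 'g set \<Rightarrow> 'g set \<Rightarrow> 'g \<Rightarrow> 'g \<times> 'g"
  where "decompose G H K g = (THE hx. fst hx \<in> H \<and> snd hx \<in> K \<and> g = fst hx \<otimes>\<^bsub>G\<^esub> snd hx)"

definition ind_rep ::
    "('g, 'b) monoid_scheme \<Rightarrow> 'g set \<Rightarrow> 'g set \<Rightarrow> ('g \<Rightarrow> complex) \<Rightarrow> 'g \<Rightarrow> ('g \<Rightarrow> complex) \<Rightarrow> 'g \<Rightarrow> complex"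
  where "ind_rep G H K \<alpha> g f =
    (let (h, x) = decompose G H K g in
      (\<lambda>y. if y \<in> K then \<alpha> (inv\<^bsub>G\<^esub> y \<otimes>\<^bsub>G\<^esub> h \<otimes>\<^bsub>G\<^esub> y) * f (inv\<^bsub>G\<^esub> x \<otimes>\<^bsub>G\<^esub> y) else 0))"

lemma decompose_mult:
  assumes "semidirect G H K" "h \<in> H" "x \<in> K"
  shows "decompose G H K (h \<otimes>\<^bsub>G\<^esub> x) = (h, x)"
proof -
  interpret H: normal H G using assms by (simp add: semidirect_def)
  interpret K: subgroup K G using assms by (simp add: semidirect_def)
  have int: "H \<inter> K = {\<one>\<^bsub>G\<^esub>}" using assms by (simp add: semidirect_def)
  have uniq: "h' = h \<and> x' = x"
    if "h' \<in> H" "x' \<in> K" and eq: "h \<otimes>\<^bsub>G\<^esub> x = h' \<otimes>\<^bsub>G\<^esub> x'" for h' x'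
  proof -
    have c: "h \<in> carrier G" "h' \<in> carrier G" "x \<in> carrier G" "x' \<in> carrier G"
      using assms that by auto
    have "inv\<^bsub>G\<^esub> h' \<otimes>\<^bsub>G\<^esub> h = inv\<^bsub>G\<^esub> h' \<otimes>\<^bsub>G\<^esub> (h \<otimes>\<^bsub>G\<^esub> x) \<otimes>\<^bsub>G\<^esub> inv\<^bsub>G\<^esub> x"
      using c by (simp add: H.m_assoc)
    also have "\<dots> = x' \<otimes>\<^bsub>G\<^esub> inv\<^bsub>G\<^esub> x"
      unfolding eq using c by (simp flip: H.m_assoc)
    finally have e: "inv\<^bsub>G\<^esub> h' \<otimes>\<^bsub>G\<^esub> h = x' \<otimes>\<^bsub>G\<^esub> inv\<^bsub>G\<^esub> x" .
    have "inv\<^bsub>G\<^esub> h' \<otimes>\<^bsub>G\<^esub> h \<in> H" "x' \<otimes>\<^bsub>G\<^esub> inv\<^bsub>G\<^esub> x \<in> K"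
      using assms that by auto
    hence "inv\<^bsub>G\<^esub> h' \<otimes>\<^bsub>G\<^esub> h = \<one>\<^bsub>G\<^esub>" using int e by auto
    hence "h = h'" using c by (metis H.inv_closed H.inv_equality H.inv_inv)
    moreover from this eq c have "x = x'" by simp
    ultimately show ?thesis by simp
  qed
  show ?thesis
    unfolding decompose_def
  proof (rule the_equality)
    fix hx assume "fst hx \<in> H \<and> snd hx \<in> K \<and> h \<otimes>\<^bsub>G\<^esub> x = fst hx \<otimes>\<^bsub>G\<^esub> snd hx"
    thus "hx = (h, x)" using uniq[of "fst hx" "snd hx"] by (simp add: prod_eq_iff)
  qed (use assms in simp)
qed

lemma ind_rep_mult:
  assumes "semidirect G H K" "h \<in> H" "x \<in> K" "y \<in> K"
  shows "ind_rep G H K \<alpha> (h \<otimes>\<^bsub>G\<^esub> x) f y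
    = \<alpha> (inv\<^bsub>G\<^esub> y \<otimes>\<^bsub>G\<^esub> h \<otimes>\<^bsub>G\<^esub> y) * f (inv\<^bsub>G\<^esub> x \<otimes>\<^bsub>G\<^esub> y)"
  using assms by (simp add: ind_rep_def decompose_mult)

lemma ind_rep_in_L2: "ind_rep G H K \<alpha> g f \<in> L2 K"
  by (auto simp: ind_rep_def L2_def split: prod.splits)


section \<open>The group of affine maps with square slope\<close>

definition nonzero_squares :: "'a::field set"
  where "nonzero_squares = {a\<^sup>2 | a. a \<noteq> 0}"

definition translation :: "'a::field \<Rightarrow> 'a \<Rightarrow> 'a"
  where "translation b = (\<lambda>x. x + b)"

definition dilation :: "'a::field \<Rightarrow> 'a \<Rightarrow> 'a"
  where "dilation a = (\<lambda>x. a * x)"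

definition translation_group :: "('a::field \<Rightarrow> 'a) set"
  where "translation_group = range translation"

definition square_dilation_group :: "('a::field \<Rightarrow> 'a) set"
  where "square_dilation_group = dilation ` nonzero_squares"

definition square_affine_group :: "('a::field \<Rightarrow> 'a) monoid"
  where "square_affine_group =
    \<lparr>carrier = {\<lambda>x. a * x + b | a b. a \<in> nonzero_squares}, monoid.mult = (\<circ>), one = id\<rparr>"

lemma nonzero_squares_closed:
  "1 \<in> nonzero_squares"
  "a \<in> nonzero_squares \<Longrightarrow> b \<in> nonzero_squares \<Longrightarrow> a * b \<in> nonzero_squares"
  "a \<in> nonzero_squares \<Longrightarrow> inverse a \<in> nonzero_squares"
  "a \<in> nonzero_squares \<Longrightarrow> a \<noteq> 0"
proof -
  show "1 \<in> nonzero_squares"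
    unfolding nonzero_squares_def by (auto intro!: exI[of _ 1])
  show "a * b \<in> nonzero_squares" if "a \<in> nonzero_squares" "b \<in> nonzero_squares"
    using that unfolding nonzero_squares_def
    by clarsimp (metis no_zero_divisors power_mult_distrib)
  show "inverse a \<in> nonzero_squares" if "a \<in> nonzero_squares"
    using that unfolding nonzero_squares_def
    by clarsimp (metis nonzero_imp_inverse_nonzero power_inverse)
qed (auto simp: nonzero_squares_def)

lemma affine_in_carrier:
  fixes a b :: "'a::field"
  shows "a \<in> nonzero_squares \<Longrightarrow> (\<lambda>x. a * x + b) \<in> carrier square_affine_group"
    and "translation b \<in> carrier square_affine_group"
    and "a \<in> nonzero_squares \<Longrightarrow> dilation a \<in> carrier square_affine_group"
    and "id \<in> carrier (square_affine_group :: ('a \<Rightarrow> 'a) monoid)"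
proof -
  have *: "(\<lambda>x. a * x + b) \<in> carrier square_affine_group" if "a \<in> nonzero_squares" for a b :: 'a
    using that by (auto simp: square_affine_group_def)
  show "a \<in> nonzero_squares \<Longrightarrow> (\<lambda>x. a * x + b) \<in> carrier square_affine_group"
    by (rule *)
  show "translation b \<in> carrier square_affine_group"
    using *[OF nonzero_squares_closed(1), of b] by (simp add: translation_def)
  show "a \<in> nonzero_squares \<Longrightarrow> dilation a \<in> carrier square_affine_group"
    using *[of a 0] by (simp add: dilation_def)
  show "id \<in> carrier (square_affine_group :: ('a \<Rightarrow> 'a) monoid)"
    using *[OF nonzero_squares_closed(1), of 0] by (simp add: id_def)
qed

lemma group_square_affine_group: "group square_affine_group"
proof (rule groupI)
  fix f g :: "'a \<Rightarrow> 'a"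
  assume "f \<in> carrier square_affine_group" "g \<in> carrier square_affine_group"
  then obtain a b c d where
    f: "f = (\<lambda>x. a * x + b)" "a \<in> nonzero_squares" and g: "g = (\<lambda>x. c * x + d)" "c \<in> nonzero_squares"
    by (auto simp: square_affine_group_def)
  have "f \<circ> g = (\<lambda>x. (a * c) * x + (a * d + b))"
    by (auto simp: f g algebra_simps)
  moreover have "a * c \<in> nonzero_squares" using f g by (simp add: nonzero_squares_closed)
  ultimately show "f \<otimes>\<^bsub>square_affine_group\<^esub> g \<in> carrier square_affine_group"
    unfolding square_affine_group_def by auto
next
  show "\<one>\<^bsub>square_affine_group\<^esub> \<in> carrier (square_affine_group :: ('a \<Rightarrow> 'a) monoid)"
    using affine_in_carrier(4) by (simp add: square_affine_group_def)
next
  fix f :: "'a \<Rightarrow> 'a" assume "f \<in> carrier square_affine_group"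
  then obtain a b where f: "f = (\<lambda>x. a * x + b)" "a \<in> nonzero_squares"
    by (auto simp: square_affine_group_def)
  let ?g = "\<lambda>x. inverse a * x + (- inverse a * b)"
  have "?g \<in> carrier square_affine_group"
    by (intro affine_in_carrier nonzero_squares_closed f)
  moreover have "?g \<circ> f = id"
    using nonzero_squares_closed(4)[OF f(2)] by (auto simp: f fun_eq_iff field_simps)
  ultimately show "\<exists>g\<in>carrier square_affine_group. g \<otimes>\<^bsub>square_affine_group\<^esub> f = \<one>\<^bsub>square_affine_group\<^esub>"
    by (auto simp: square_affine_group_def)
qed (auto simp: square_affine_group_def comp_assoc)

lemma inv_translation:
  "inv\<^bsub>square_affine_group\<^esub> (translation b) = translation (- b :: 'a::field)"
proof -
  interpret group "square_affine_group :: ('a \<Rightarrow> 'a) monoid" by (rule group_square_affine_group)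
  show ?thesis
    by (intro inv_equality affine_in_carrier)
      (auto simp: square_affine_group_def translation_def)
qed

lemma inv_dilation:
  assumes "a \<in> nonzero_squares"
  shows "inv\<^bsub>square_affine_group\<^esub> (dilation a) = dilation (inverse a :: 'a::field)"
proof -
  interpret group "square_affine_group :: ('a \<Rightarrow> 'a) monoid" by (rule group_square_affine_group)
  show ?thesis
    using assms nonzero_squares_closed(3,4)[OF assms]
    by (intro inv_equality affine_in_carrier)
      (auto simp: square_affine_group_def dilation_def fun_eq_iff)
qed

lemma semidirect_square_affine_group:
  "semidirect (square_affine_group :: ('a::field \<Rightarrow> 'a) monoid) translation_group square_dilation_group"
proof -
  let ?G = "square_affine_group :: ('a \<Rightarrow> 'a) monoid"
  interpret group ?G by (rule group_square_affine_group)
  note carr = affine_in_carrier(2,3)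
  have mult: "f \<otimes>\<^bsub>?G\<^esub> g = f \<circ> g" for f g by (simp add: square_affine_group_def)
  have one: "\<one>\<^bsub>?G\<^esub> = id" by (simp add: square_affine_group_def)
  have sH: "subgroup translation_group ?G"
  proof (rule subgroupI)
    show "translation_group \<subseteq> carrier ?G" using carr by (auto simp: translation_group_def)
    show "translation_group \<noteq> ({} :: ('a \<Rightarrow> 'a) set)" by (auto simp: translation_group_def)
    show "inv\<^bsub>?G\<^esub> f \<in> translation_group" if "f \<in> translation_group" for f
      using that by (auto simp: translation_group_def inv_translation)
    show "f \<otimes>\<^bsub>?G\<^esub> g \<in> translation_group" if fg: "f \<in> translation_group" "g \<in> translation_group" for f g
    proof -
      obtain a b where "f = translation a" "g = translation b"
        using fg by (auto simp: translation_group_def)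
      hence "f \<circ> g = translation (b + a)" by (auto simp: translation_def fun_eq_iff)
      thus ?thesis by (simp add: mult translation_group_def)
    qed
  qed
  have sK: "subgroup square_dilation_group ?G"
  proof (rule subgroupI)
    show "square_dilation_group \<subseteq> carrier ?G" using carr by (auto simp: square_dilation_group_def)
    show "square_dilation_group \<noteq> ({} :: ('a \<Rightarrow> 'a) set)"
      using nonzero_squares_closed(1) by (auto simp: square_dilation_group_def)
    show "inv\<^bsub>?G\<^esub> f \<in> square_dilation_group" if "f \<in> square_dilation_group" for f
      using that by (auto simp: square_dilation_group_def inv_dilation nonzero_squares_closed)
    show "f \<otimes>\<^bsub>?G\<^esub> g \<in> square_dilation_group" if fg: "f \<in> square_dilation_group" "g \<in> square_dilation_group" for f g
    proof -
      obtain a b where ab: "f = dilation a" "g = dilation b" "a \<in> nonzero_squares" "b \<in> nonzero_squares"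
        using fg by (auto simp: square_dilation_group_def)
      hence "f \<circ> g = dilation (a * b)" by (auto simp: dilation_def fun_eq_iff)
      thus ?thesis using ab by (simp add: mult square_dilation_group_def nonzero_squares_closed)
    qed
  qed
  have "translation_group \<lhd> ?G"
    unfolding normal_inv_iff
  proof (intro conjI sH ballI)
    fix f h :: "'a \<Rightarrow> 'a"
    assume f: "f \<in> carrier ?G" and "h \<in> translation_group"
    then obtain a b c where
      fh: "f = (\<lambda>x. a * x + b)" "a \<in> nonzero_squares" "h = translation c"
      by (auto simp: square_affine_group_def translation_group_def)
    have "f \<otimes>\<^bsub>?G\<^esub> h = translation (a * c) \<otimes>\<^bsub>?G\<^esub> f"
      by (auto simp: fh mult translation_def fun_eq_iff algebra_simps)
    hence "f \<otimes>\<^bsub>?G\<^esub> h \<otimes>\<^bsub>?G\<^esub> inv\<^bsub>?G\<^esub> f = translation (a * c)"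
      using f by (simp add: m_assoc carr)
    thus "f \<otimes>\<^bsub>?G\<^esub> h \<otimes>\<^bsub>?G\<^esub> inv\<^bsub>?G\<^esub> f \<in> translation_group" by (simp add: translation_group_def)
  qed
  moreover have "translation_group \<inter> square_dilation_group = {\<one>\<^bsub>?G\<^esub>}"
  proof
    show "translation_group \<inter> square_dilation_group \<subseteq> {\<one>\<^bsub>?G\<^esub>}"
    proof
      fix f assume "f \<in> translation_group \<inter> (square_dilation_group :: ('a \<Rightarrow> 'a) set)"
      then obtain a b where e: "f = translation b" "f = dilation a"
        unfolding translation_group_def square_dilation_group_def by blast
      have "f 0 = b" unfolding e(1) by (simp add: translation_def)
      moreover have "f 0 = 0" unfolding e(2) by (simp add: dilation_def)
      ultimately show "f \<in> {\<one>\<^bsub>?G\<^esub>}" using e(1) by (auto simp: one translation_def)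
    qed
    show "{\<one>\<^bsub>?G\<^esub>} \<subseteq> translation_group \<inter> square_dilation_group"
      using subgroup.one_closed[OF sH] subgroup.one_closed[OF sK] by auto
  qed
  moreover have "translation_group <#>\<^bsub>?G\<^esub> square_dilation_group = carrier ?G"
  proof
    show "translation_group <#>\<^bsub>?G\<^esub> square_dilation_group \<subseteq> carrier ?G"
      using sH sK by (intro set_mult_closed subgroup.subset)
    show "carrier ?G \<subseteq> translation_group <#>\<^bsub>?G\<^esub> square_dilation_group"
    proof
      fix f assume "f \<in> carrier ?G"
      then obtain a b where f: "f = (\<lambda>x. a * x + b)" "a \<in> nonzero_squares"
        by (auto simp: square_affine_group_def)
      have "f = translation b \<otimes>\<^bsub>?G\<^esub> dilation a"
        by (auto simp: f mult translation_def dilation_def)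
      thus "f \<in> translation_group <#>\<^bsub>?G\<^esub> square_dilation_group"
        using f(2) unfolding set_mult_def translation_group_def square_dilation_group_def by blast
    qed
  qed
  ultimately show ?thesis using sK by (simp add: semidirect_def)
qed


section \<open>The trace and the trace character of a finite field\<close>

text \<open>
  For a field with \<open>p ^ r\<close> elements, the Galois group over the prime field is generated by
  \<open>c \<mapsto> c ^ p\<close>, so the field trace is the sum of the conjugates \<open>c ^ (p ^ i)\<close>, \<open>i < r\<close>.
  It lies in the prime field, whose elements are the images of \<open>0, \<dots>, p - 1\<close> under \<^term>\<open>of_nat\<close>;
  \<open>trace_residue\<close> is the representative of the trace in that range.
\<close>

definition field_trace :: "nat \<Rightarrow> nat \<Rightarrow> 'a::finite_field \<Rightarrow> 'a"
  where "field_trace p r c = (\<Sum>i<r. c ^ (p ^ i))"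

definition trace_residue :: "nat \<Rightarrow> nat \<Rightarrow> 'a::finite_field \<Rightarrow> nat"
  where "trace_residue p r c = (THE k. k < p \<and> of_nat k = field_trace p r c)"

text \<open>The argument is the translation by \<open>c\<close>, which maps \<open>0\<close> to \<open>c\<close>.\<close>

definition trace_char :: "nat \<Rightarrow> nat \<Rightarrow> ('a::finite_field \<Rightarrow> 'a) \<Rightarrow> complex"
  where "trace_char p r h = exp (2 * of_real pi * \<i> / of_nat p) ^ trace_residue p r (h 0)"

context
  fixes p r :: nat
  assumes p: "prime p" and card: "CARD('a::finite_field) = p ^ r"
begin

lemma CHAR_eq_prime: "CHAR('a) = p"
proof -
  have "CHAR('a) dvd p ^ r" using CHAR_dvd_CARD[where 'a = 'a] by (simp add: card)
  moreover have "prime CHAR('a)" by simp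
  ultimately show ?thesis using p by (metis prime_dvd_power primes_dvd_imp_eq)
qed

lemma field_trace_power: "field_trace p r c ^ p = field_trace p r (c :: 'a)"
proof -
  have "field_trace p r c ^ p = (\<Sum>i<r. (c ^ (p ^ i)) ^ p)"
    unfolding field_trace_def using p CHAR_eq_prime by (intro freshmans_dream_sum) auto
  also have "\<dots> = (\<Sum>i<r. c ^ (p ^ Suc i))"
    by (simp add: power_mult[symmetric] mult.commute)
  also have "\<dots> + c ^ (p ^ 0) = (\<Sum>i<Suc r. c ^ (p ^ i))"
    by (subst sum.lessThan_Suc_shift) (simp add: add.commute)
  also have "\<dots> = (\<Sum>i<r. c ^ (p ^ i)) + c ^ (p ^ r)" by simp
  also have "c ^ (p ^ r) = c ^ (p ^ 0)"
    using finite_field_power_card_eq_same[of c] by (simp add: card)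
  finally show ?thesis by (simp add: field_trace_def)
qed

lemma trace_residue_ex1: "\<exists>!k. k < p \<and> of_nat k = field_trace p r (c :: 'a)"
proof -
  have inj: "k = l" if kl: "k \<le> l" "l < p" and eq: "of_nat k = (of_nat l :: 'a)" for k l
  proof -
    have "of_nat (l - k) = (0 :: 'a)" using kl eq by (simp add: of_nat_diff)
    hence "p dvd l - k" by (simp add: of_nat_eq_0_iff_char_dvd CHAR_eq_prime)
    moreover have "l - k < p" using kl by simp
    ultimately have "l - k = 0" using nat_dvd_not_less by blast
    thus ?thesis using kl by simp
  qed
  have eq_iff: "of_nat k = (of_nat l :: 'a) \<longleftrightarrow> k = l" if "k < p" "l < p" for k l
    using inj[of k l] inj[of l k] that by (cases k l rule: linorder_le_cases) auto
  let ?P = "Polynomial.monom 1 p - Polynomial.monom 1 1 :: 'a poly"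
  let ?R = "{x. poly ?P x = 0}"
  have p1: "p > 1" using p by (rule prime_gt_1_nat)
  have "Polynomial.coeff ?P p = 1" using p1 by simp
  hence P0: "?P \<noteq> 0" by (metis Polynomial.coeff_0 zero_neq_one)
  have "Polynomial.degree ?P \<le> p" using p1 by (intro degree_diff_le) (auto simp: degree_monom_eq)
  hence R: "card ?R \<le> p" using card_poly_roots_bound[OF P0] by simp
  have in_R: "x \<in> ?R \<longleftrightarrow> x ^ p = x" for x by (simp add: poly_monom)
  have ofnat_pow: "of_nat k ^ p = (of_nat k :: 'a)" for k
    by (induction k)
      (use p p1 CHAR_eq_prime in \<open>auto simp: freshmans_dream power_0_left\<close>)
  have sub: "of_nat ` {..<p} \<subseteq> ?R" using in_R ofnat_pow by auto
  have "card (of_nat ` {..<p} :: 'a set) = p"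
    using eq_iff by (subst card_image) (auto simp: inj_on_def)
  hence "of_nat ` {..<p} = ?R" using sub R by (intro card_seteq) auto
  moreover have "field_trace p r c \<in> ?R" using field_trace_power in_R by simp
  ultimately obtain k where "k < p" "field_trace p r c = of_nat k" by auto
  thus ?thesis using eq_iff by (intro ex1I[of _ k]) auto
qed

lemma trace_residue:
  "trace_residue p r (c :: 'a) < p" "of_nat (trace_residue p r c) = field_trace p r (c :: 'a)"
  using theI'[OF trace_residue_ex1[of c]] by (auto simp: trace_residue_def)

lemma trace_char_translation:
  assumes "of_nat k = field_trace p r (c :: 'a)"
  shows "trace_char p r (translation c) = exp (2 * of_real pi * \<i> / of_nat p) ^ k"
proof -
  have p0: "p > 0" using p by (rule prime_gt_0_nat)
  have "of_nat p = (0 :: 'a)" using of_nat_CHAR[where 'a = 'a] by (simp add: CHAR_eq_prime)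
  hence "of_nat (p * (k div p) + k mod p) = (of_nat (k mod p) :: 'a)"
    by (simp only: of_nat_add of_nat_mult mult_zero_left add_0_left)
  hence "of_nat (k mod p) = field_trace p r c"
    using assms by simp
  hence "trace_residue p r c = k mod p"
    unfolding trace_residue_def using p0 by (intro the1_equality trace_residue_ex1) simp
  moreover have "exp (2 * of_real pi * \<i> / of_nat p) ^ p = (1 :: complex)"
    using p0 by (simp flip: exp_of_nat_mult)
  hence "exp (2 * of_real pi * \<i> / of_nat p) ^ k = exp (2 * of_real pi * \<i> / of_nat p :: complex) ^ (k mod p)"
    by (metis mult_div_mod_eq mult_1_left power_add power_mult power_one)
  ultimately show ?thesis by (simp add: trace_char_def translation_def)
qed

lemma character_trace_char:
  "character (square_affine_group :: ('a \<Rightarrow> 'a) monoid) translation_group (trace_char p r)"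
  unfolding character_def
proof (intro conjI ballI)
  fix h :: "'a \<Rightarrow> 'a"
  have "cmod (exp (2 * of_real pi * \<i> / of_nat p)) = 1" by simp
  thus "cmod (trace_char p r h) = 1" by (simp add: trace_char_def norm_power)
next
  fix h h' :: "'a \<Rightarrow> 'a" assume "h \<in> translation_group" "h' \<in> translation_group"
  then obtain b c where bc: "h = translation b" "h' = translation c"
    by (auto simp: translation_group_def)
  have "field_trace p r (b + c) = field_trace p r b + field_trace p r c"
    unfolding field_trace_def sum.distrib[symmetric] using p CHAR_eq_prime
    by (intro sum.cong refl freshmans_dream') auto
  hence "of_nat (trace_residue p r b + trace_residue p r c) = field_trace p r (b + c)"
    by (simp add: trace_residue)
  moreover have "h \<otimes>\<^bsub>square_affine_group\<^esub> h' = translation (b + c)"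
    by (auto simp: bc square_affine_group_def translation_def)
  ultimately show "trace_char p r (h \<otimes>\<^bsub>square_affine_group\<^esub> h') = trace_char p r h * trace_char p r h'"
    using trace_char_translation[of "trace_residue p r b + trace_residue p r c" "b + c"]
      trace_char_translation[OF trace_residue(2)] by (simp add: bc power_add)
qed

end

end

theory Submission
  imports Defs
begin

text \<open>
  Write \<open>\<psi>\<close> for the character \<open>c \<mapsto> \<omega> ^ tr c\<close>, \<open>Q\<close> for the set of nonzero squares and
  \<open>n = (q - 1) / 2\<close> for its size. As \<open>f\<close> is constant, the vector of the transformation
  \<open>x \<mapsto> a x + b\<close> depends only on \<open>b\<close>; it is \<open>\<theta>\<^sub>y \<mapsto> \<psi> (b / y) / \<surd>n\<close>. Orthogonality of characters
  makes these \<open>q\<close> vectors a tight frame. The inner product of the vectors of \<open>b\<close> and \<open>c\<close> is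
  \<open>S (b - c) / n\<close> with \<open>S t = (\<Sum>y\<in>Q. \<psi> (t y))\<close>. Since \<open>q \<equiv> 3 (mod 4)\<close>, every \<open>t \<noteq> 0\<close> is plus or
  minus a square, so \<open>S t\<close> is \<open>S 1\<close> or its conjugate, and \<open>\<bar>S t\<bar>\<close> is constant. Parseval then gives
  \<open>\<bar>S 1\<bar>\<^sup>2 = (q + 1) / 4\<close>, which is less than \<open>n\<^sup>2\<close> when \<open>q > 3\<close>, so the \<open>q\<close> lines are distinct.
\<close>

section \<open>Characters of the additive group of a finite field\<close>

text \<open>The character lives on field elements rather than on translations, so that its argument
  can be scaled. These three properties are all that the frame argument uses of the trace
  character.\<close>

locale additive_character =
  fixes \<psi> :: "'a::finite_field \<Rightarrow> complex"
  assumes add: "\<psi> (x + y) = \<psi> x * \<psi> y"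
    and norm_1 [simp]: "cmod (\<psi> x) = 1"
    and nontrivial: "\<exists>x. \<psi> x \<noteq> 1"
begin

lemma nonzero: "\<psi> x \<noteq> 0"
  using norm_1[of x] by (metis norm_zero zero_neq_one)

lemma zero [simp]: "\<psi> 0 = 1"
  using add[of 0 0] nonzero[of 0] by simp

lemma cnj_eq: "cnj (\<psi> x) = \<psi> (- x)"
proof -
  have "\<psi> x * cnj (\<psi> x) = \<psi> x * \<psi> (- x)"
    using complex_norm_square[of "\<psi> x"] add[of x "- x"] by simp
  thus ?thesis using nonzero by simp
qed

lemma sum_UNIV: "(\<Sum>b\<in>UNIV. \<psi> b) = 0"
proof -
  obtain c where c: "\<psi> c \<noteq> 1" using nontrivial by blast
  have "(\<Sum>b\<in>UNIV. \<psi> b) = (\<Sum>b\<in>UNIV. \<psi> (c + b))"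
    by (rule sum.reindex_bij_witness[of _ "\<lambda>b. c + b" "\<lambda>b. b - c"]) auto
  also have "\<dots> = \<psi> c * (\<Sum>b\<in>UNIV. \<psi> b)" by (simp add: add sum_distrib_left)
  finally show ?thesis using c by simp
qed

lemma sum_mult_UNIV: "(\<Sum>b\<in>UNIV. \<psi> (b * t)) = (if t = 0 then of_nat CARD('a) else 0)"
proof (cases "t = 0")
  case False
  have "(\<Sum>b\<in>UNIV. \<psi> (b * t)) = (\<Sum>b\<in>UNIV. \<psi> b)"
    by (rule sum.reindex_bij_witness[of _ "\<lambda>b. b / t" "\<lambda>b. b * t"]) (use False in auto)
  with False show ?thesis by (simp add: sum_UNIV)
qed simp

text \<open>Expanding the square and summing over \<open>b\<close> first leaves only the diagonal,
  by orthogonality and injectivity of \<open>v\<close>. The choice \<open>v y = y\<close> gives the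
  size of the sums over squares; \<open>v = inverse\<close> gives tightness of the frame.\<close>

lemma parseval:
  assumes "finite A" "inj_on v A"
  shows "(\<Sum>b\<in>UNIV. (cmod (\<Sum>y\<in>A. g y * cnj (\<psi> (b * v y))))\<^sup>2)
    = CARD('a) * (\<Sum>y\<in>A. (cmod (g y))\<^sup>2)"
proof -
  have "complex_of_real (\<Sum>b\<in>UNIV. (cmod (\<Sum>y\<in>A. g y * cnj (\<psi> (b * v y))))\<^sup>2)
      = (\<Sum>b\<in>UNIV. (\<Sum>y\<in>A. g y * cnj (\<psi> (b * v y))) * (\<Sum>z\<in>A. cnj (g z) * \<psi> (b * v z)))"
    by (simp add: complex_norm_square del: of_real_power)
  also have "\<dots> = (\<Sum>b\<in>UNIV. \<Sum>y\<in>A. \<Sum>z\<in>A. g y * cnj (g z) * \<psi> (b * (v z - v y)))"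
    unfolding sum_product
  proof (intro sum.cong refl)
    fix b y z
    have "\<psi> (b * (v z - v y)) = \<psi> (b * v z) * cnj (\<psi> (b * v y))"
      using add[of "b * v z" "- (b * v y)"] by (simp add: cnj_eq right_diff_distrib)
    thus "g y * cnj (\<psi> (b * v y)) * (cnj (g z) * \<psi> (b * v z))
        = g y * cnj (g z) * \<psi> (b * (v z - v y))" by simp
  qed
  also have "\<dots> = (\<Sum>y\<in>A. \<Sum>z\<in>A. g y * cnj (g z) * (\<Sum>b\<in>UNIV. \<psi> (b * (v z - v y))))"
    by (subst sum.swap, subst sum.swap[of _ _ UNIV]) (simp add: sum_distrib_left)
  also have "\<dots> = (\<Sum>y\<in>A. \<Sum>z\<in>A. if z = y then of_nat CARD('a) * (g y * cnj (g y)) else 0)"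
    using assms(2) by (intro sum.cong refl) (auto simp: sum_mult_UNIV inj_on_def)
  also have "\<dots> = complex_of_real (CARD('a) * (\<Sum>y\<in>A. (cmod (g y))\<^sup>2))"
    using assms(1) by (simp add: complex_norm_square sum_distrib_left del: of_real_power)
  finally show ?thesis by (simp only: of_real_eq_iff)
qed

end

text \<open>The trace is a nonzero polynomial of degree at most \<open>p ^ (r - 1)\<close>, so it
  cannot vanish at all \<open>p ^ r\<close> elements.\<close>

lemma field_trace_nonzero:
  assumes "prime p" "CARD('a::finite_field) = p ^ r"
  shows "\<exists>c::'a. field_trace p r c \<noteq> 0"
proof (rule ccontr)
  assume "\<not> ?thesis"
  hence zero: "field_trace p r c = 0" for c :: 'a by blast
  let ?P = "\<Sum>i<r. Polynomial.monom 1 (p ^ i) :: 'a poly"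
  have p1: "p > 1" using assms(1) by (rule prime_gt_1_nat)
  have "r \<noteq> 0"
    using assms(2) card_mono[of "UNIV :: 'a set" "{0, 1}"] by (cases r) auto
  then obtain k where k: "r = Suc k" by (cases r) auto
  \<comment> \<open>As \<open>p > 1\<close>, the exponents \<open>p ^ i\<close> are distinct, so
    only the summand \<open>i = k\<close> contributes.\<close>
  have "Polynomial.coeff ?P (p ^ k) = (\<Sum>i<r. if i = k then 1 else 0)"
    using p1 by (simp add: coeff_sum)
  hence "Polynomial.coeff ?P (p ^ k) = 1" by (simp add: k)
  hence "?P \<noteq> 0" by (metis Polynomial.coeff_0 zero_neq_one)
  moreover have "{x. poly ?P x = 0} = UNIV"
    using zero by (simp add: field_trace_def poly_sum poly_monom)
  ultimately have "p ^ r \<le> Polynomial.degree ?P"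
    using card_poly_roots_bound[of ?P] assms(2) by simp
  also have "\<dots> \<le> p ^ k"
    using p1 by (intro degree_sum_le) (auto simp: degree_monom_eq k)
  also have "\<dots> < p ^ r" using p1 by (simp add: k)
  finally show False by simp
qed

lemma additive_character_trace_char:
  assumes p: "prime p" and card: "CARD('a::finite_field) = p ^ r"
  shows "additive_character (\<lambda>c::'a. trace_char p r (translation c))"
proof
  fix x y :: 'a
  have *: "translation (x + y) = translation x \<otimes>\<^bsub>square_affine_group\<^esub> translation y"
    by (auto simp: square_affine_group_def translation_def)
  have mem: "translation c \<in> translation_group" for c :: 'a
    by (simp add: translation_group_def)
  note ch = character_trace_char[OF p card, unfolded character_def]
  show "trace_char p r (translation (x + y))
      = trace_char p r (translation x) * trace_char p r (translation y)"
    unfolding * using ch mem by blast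
  show "cmod (trace_char p r (translation x)) = 1" using ch mem by blast
next
  obtain c :: 'a where c: "field_trace p r c \<noteq> 0" using field_trace_nonzero[OF p card] by blast
  let ?k = "trace_residue p r c"
  \<comment> \<open>The image of \<open>?k\<close> in the field is the nonzero trace of
    \<open>c\<close>. With \<open>0 < ?k < p\<close>, the power \<open>?k\<close> of a primitive
    \<open>p\<close>-th root of unity differs from 1.\<close>
  have "?k \<noteq> 0" "?k < p" using trace_residue[OF p card, of c] c by (auto intro: ccontr)
  have p0: "p > 0" using p by (rule prime_gt_0_nat)
  have "trace_char p r (translation c) = exp (2 * of_real pi * \<i> / of_nat p) ^ ?k"
    by (rule trace_char_translation[OF p card]) (simp add: trace_residue[OF p card])
  also have "\<dots> = cis (2 * pi / p) ^ ?k"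
    by (simp add: cis_conv_exp mult_ac)
  also have "\<dots> = cis (2 * pi * ?k / p)" by (simp add: DeMoivre mult_ac)
  also have "\<dots> \<noteq> 1"
    using inj_onD[OF bij_betw_imp_inj_on[OF bij_betw_roots_unity[OF p0]], of ?k 0]
      \<open>?k \<noteq> 0\<close> \<open>?k < p\<close> p0 by auto
  finally show "\<exists>c::'a. trace_char p r (translation c) \<noteq> 1" by blast
qed

section \<open>Squares in fields of order 3 modulo 4\<close>

text \<open>Here \<open>q = 1 + 2 * (2 * m + 1)\<close>, so a root \<open>x\<close> of -1 satisfies
  \<open>x ^ q = - x\<close>. But \<open>x ^ q = x\<close>, which forces characteristic 2, although
  \<open>q\<close> is odd.\<close>

lemma minus_one_not_square:
  assumes "CARD('a::finite_field) mod 4 = 3"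
  shows "(x::'a)\<^sup>2 \<noteq> - 1"
proof
  assume x: "x\<^sup>2 = - 1"
  define m where "m = CARD('a) div 4"
  have q: "CARD('a) = Suc (2 * Suc (2 * m))"
    using assms div_mult_mod_eq[of "CARD('a)" 4] by (simp add: m_def)
  have "x ^ CARD('a) = x * (x\<^sup>2) ^ Suc (2 * m)"
    unfolding q by (simp only: power_Suc power_mult)
  also have "\<dots> = - x" by (simp add: x)
  finally have "x = - x" by (simp add: finite_field_power_card_eq_same)
  hence "of_nat 2 * x = 0" by (metis add.right_inverse mult_2 of_nat_numeral)
  moreover have "x \<noteq> 0" using x by auto
  ultimately have "of_nat 2 = (0::'a)" by simp
  hence "CHAR('a) dvd 2" by (simp only: of_nat_eq_0_iff_char_dvd)
  moreover have "prime CHAR('a)" by simp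
  ultimately have "CHAR('a) = 2" using two_is_prime_nat primes_dvd_imp_eq by blast
  hence "2 dvd CARD('a)" using CHAR_dvd_CARD[where 'a = 'a] by simp
  thus False by (simp add: q)
qed

text \<open>A square with square negative would make -1 a square. Squaring is two-to-one on nonzero
  elements, which gives the count.\<close>

lemma squares_mod_4_eq_3:
  assumes "CARD('a::finite_field) mod 4 = 3"
  shows nonzero_squares_disjoint: "a \<in> nonzero_squares \<Longrightarrow> (- a :: 'a) \<notin> nonzero_squares"
    and card_nonzero_squares: "card (nonzero_squares :: 'a set) = (CARD('a) - 1) div 2"
    and nonzero_squares_cases: "(t :: 'a) \<noteq> 0 \<Longrightarrow> t \<in> nonzero_squares \<or> - t \<in> nonzero_squares"
proof -
  let ?Q = "nonzero_squares :: 'a set"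
  show disj: "- a \<notin> ?Q" if a: "a \<in> ?Q" for a
  proof
    assume "- a \<in> ?Q"
    then obtain y where y: "y\<^sup>2 = - a" by (auto simp: nonzero_squares_def)
    obtain x where x: "a = x\<^sup>2" "x \<noteq> 0" using a by (auto simp: nonzero_squares_def)
    have "(y / x)\<^sup>2 = - 1" using x by (simp add: power_divide y)
    thus False using minus_one_not_square[OF assms] by blast
  qed
  \<comment> \<open>If \<open>x = - x\<close>, then \<open>x\<^sup>2 = x * x\<close> equals
    \<open>(- x) * x\<close>, so a nonzero square would be its own negative.\<close>
  have neq: "x \<noteq> - x" if "x \<noteq> 0" for x :: 'a
  proof
    assume x: "x = - x"
    have "x\<^sup>2 \<in> ?Q" using that by (auto simp: nonzero_squares_def)
    moreover have "- (x\<^sup>2) = x\<^sup>2" using x by (metis mult_minus_left power2_eq_square)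
    ultimately show False using disj by metis
  qed
  have "card (UNIV - {0::'a}) = (\<Sum>a\<in>?Q. card {x. x \<noteq> 0 \<and> x\<^sup>2 = a})"
  proof -
    have "UNIV - {0::'a} = (\<Union>a\<in>?Q. {x. x \<noteq> 0 \<and> x\<^sup>2 = a})"
      by (auto simp: nonzero_squares_def)
    thus ?thesis by (simp only:) (subst card_UN_disjoint; auto)
  qed
  also have "\<dots> = (\<Sum>a\<in>?Q. 2)"
  proof (intro sum.cong refl)
    fix a assume "a \<in> ?Q"
    then obtain x where x: "a = x\<^sup>2" "x \<noteq> 0" by (auto simp: nonzero_squares_def)
    have "{y. y \<noteq> 0 \<and> y\<^sup>2 = a} = {x, - x}" using x by (auto simp: power2_eq_iff)
    thus "card {y. y \<noteq> 0 \<and> y\<^sup>2 = a} = 2" using neq[OF x(2)] by simp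
  qed
  finally have card: "card (UNIV - {0::'a}) = 2 * card ?Q" by simp
  thus "card ?Q = (CARD('a) - 1) div 2" by (simp add: card_Diff_singleton)
  show "t \<in> ?Q \<or> - t \<in> ?Q" if "t \<noteq> 0"
  proof -
    \<comment> \<open>The squares and their negatives are disjoint and equinumerous, so together
      they exhaust the nonzero elements.\<close>
    have "card (?Q \<union> uminus ` ?Q) = 2 * card ?Q"
      using disj by (subst card_Un_disjoint) (auto simp: card_image inj_on_def)
    hence "?Q \<union> uminus ` ?Q = UNIV - {0}"
      using card by (intro card_subset_eq) (auto dest: nonzero_squares_closed(4))
    thus ?thesis using that by (metis DiffI UNIV_I Un_iff imageE minus_minus singletonD)
  qed
qed

section \<open>Character sums over the nonzero squares\<close>

context additive_character
begin

text \<open>A quadratic Gaussian period: for odd \<open>q\<close>,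
  \<open>1 + 2 * square_sum t\<close> is the Gauss sum of \<open>\<psi> (t * x\<^sup>2)\<close> over
  all \<open>x\<close>.\<close>

definition square_sum :: "'a \<Rightarrow> complex"
  where "square_sum t = (\<Sum>y\<in>nonzero_squares. \<psi> (t * y))"

lemma square_sum_zero: "square_sum 0 = of_nat (card (nonzero_squares :: 'a set))"
  by (simp add: square_sum_def)

lemma square_sum_uminus: "square_sum (- t) = cnj (square_sum t)"
  by (simp add: square_sum_def cnj_eq)

lemma square_sum_square:
  assumes "t \<in> nonzero_squares"
  shows "square_sum t = square_sum 1"
  unfolding square_sum_def
  by (rule sum.reindex_bij_witness[of _ "\<lambda>y. inverse t * y" "\<lambda>y. t * y"])
    (use assms nonzero_squares_closed(4)[OF assms] in
      \<open>auto simp: nonzero_squares_closed simp flip: mult.assoc\<close>)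

lemma norm_square_sum_eq:
  assumes "CARD('a) mod 4 = 3" "t \<noteq> 0"
  shows "cmod (square_sum t) = cmod (square_sum 1)"
  using nonzero_squares_cases[OF assms]
  by (metis complex_mod_cnj square_sum_square square_sum_uminus)

text \<open>Parseval for the constant 1 on the \<open>n = (q - 1) / 2\<close> squares reads
  \<open>q * n = n\<^sup>2 + (q - 1) * \<bar>S t\<bar>\<^sup>2\<close>: the term at 0 is
  \<open>n\<^sup>2\<close>, and the other \<open>q - 1\<close> terms agree.\<close>

lemma norm_square_sum:
  assumes "CARD('a) mod 4 = 3" "t \<noteq> 0"
  shows "(cmod (square_sum t))\<^sup>2 = (real CARD('a) + 1) / 4"
proof -
  let ?q = "real CARD('a)" and ?Q = "nonzero_squares :: 'a set"
  have q3: "CARD('a) \<ge> 3" using assms(1) by (metis mod_less_eq_dividend)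
  have n: "real (card ?Q) = (?q - 1) / 2"
  proof -
    have "CARD('a) = 2 * card ?Q + 1"
      using card_nonzero_squares[OF assms(1)] assms(1) by presburger
    thus ?thesis by simp
  qed
  have "?q * real (card ?Q) = (\<Sum>b\<in>UNIV. (cmod (\<Sum>y\<in>?Q. 1 * cnj (\<psi> (b * y))))\<^sup>2)"
    by (subst parseval) (auto simp: inj_on_def)
  also have "\<dots> = (\<Sum>b\<in>UNIV. (cmod (square_sum b))\<^sup>2)"
    by (simp add: square_sum_def flip: cnj_sum)
  also have "\<dots> = (real (card ?Q))\<^sup>2 + (\<Sum>b\<in>UNIV - {0}. (cmod (square_sum b))\<^sup>2)"
    by (subst sum.remove[of _ 0]) (auto simp: square_sum_zero)
  also have "(\<Sum>b\<in>UNIV - {0}. (cmod (square_sum b))\<^sup>2)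
      = (\<Sum>b\<in>UNIV - {0::'a}. (cmod (square_sum t))\<^sup>2)"
    by (intro sum.cong refl arg_cong[of _ _ "\<lambda>x. x\<^sup>2"])
      (metis DiffD2 assms norm_square_sum_eq singletonI)
  also have "\<dots> = (?q - 1) * (cmod (square_sum t))\<^sup>2"
    using q3 by (simp add: card_Diff_singleton of_nat_diff)
  finally have "(?q - 1) * (cmod (square_sum t))\<^sup>2 = (?q - 1) * ((?q + 1) / 4)"
    unfolding n by (simp add: power2_eq_square field_simps)
  thus ?thesis using q3 by simp
qed

end

section \<open>The orbit of the constant function\<close>

lemma dim_L2:
  fixes K :: "'k set"
  assumes "finite K"
  shows "cfun.dim (L2 K) = card K"
proof -
  define e :: "'k \<Rightarrow> 'k \<Rightarrow> complex" where "e = (\<lambda>x y. if y = x then 1 else 0)"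
  have inj: "inj_on e A" for A by (auto simp: inj_on_def e_def fun_eq_iff split: if_splits)
  \<comment> \<open>The coefficient \<open>u\<close> is a function of the basis vector, the form in
    which \<open>cfun.dependent_finite\<close> states linear relations.\<close>
  have expand: "(\<Sum>x\<in>K. fun_scale (u (e x)) (e x)) y = (if y \<in> K then u (e y) else 0)" for u y
  proof -
    have "(\<Sum>x\<in>K. fun_scale (u (e x)) (e x)) y = (\<Sum>x\<in>K. fun_scale (u (e x)) (e x) y)"
      using assms by (induction K rule: finite_induct) auto
    also have "\<dots> = (\<Sum>x\<in>K. if x = y then u (e y) else 0)"
      by (intro sum.cong) (auto simp: fun_scale_def e_def)
    finally show ?thesis using assms by simp
  qed
  show ?thesis
  proof (rule cfun.dim_unique[of "e ` K"])
    show "e ` K \<subseteq> L2 K" by (auto simp: e_def L2_def)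
    show "card (e ` K) = card K" by (rule card_image[OF inj])
    show "cfun.independent (e ` K)"
      unfolding cfun.dependent_finite[OF finite_imageI[OF assms]]
      by (auto simp: sum.reindex[OF inj] expand dest!: fun_cong split: if_splits)
    show "L2 K \<subseteq> cfun.span (e ` K)"
    proof
      fix g :: "'k \<Rightarrow> complex" assume g: "g \<in> L2 K"
      define u where "u = (\<lambda>h. g (inv_into UNIV e h))"
      have u: "u (e x) = g x" for x by (simp add: u_def inj)
      have "g = (\<Sum>x\<in>K. fun_scale (u (e x)) (e x))"
      proof
        fix y
        show "g y = (\<Sum>x\<in>K. fun_scale (u (e x)) (e x)) y"
          unfolding expand using g by (simp add: u L2_def)
      qed
      also have "\<dots> \<in> cfun.span (e ` K)"
        by (intro cfun.span_sum cfun.span_scale cfun.span_base) auto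
      finally show "g \<in> cfun.span (e ` K)" .
    qed
  qed
qed

text \<open>If \<open>u = k v\<close>, the inner product is \<open>k\<close>, and normalization
  gives \<open>k\<close> modulus 1. An inner product of another modulus thus separates
  lines.\<close>

lemma unit_vectors_same_line:
  assumes "cfun.span {u} = cfun.span {v}" "l2_inner K u u = 1" "l2_inner K v v = 1"
  shows "cmod (l2_inner K u v) = 1"
proof -
  have "u \<in> cfun.span {v}" using assms(1) cfun.span_base[of u "{u}"] by simp
  then obtain k where u: "u = fun_scale k v" by (auto simp: cfun.span_singleton)
  have uv: "l2_inner K u v = k"
    using assms(3) by (simp add: u l2_inner_def fun_scale_def mult.assoc flip: sum_distrib_left)
  have "l2_inner K u u = k * cnj k * l2_inner K v v"
    by (simp add: u l2_inner_def fun_scale_def sum_distrib_left mult_ac)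
  hence "of_real ((cmod k)\<^sup>2) = (1::complex)"
    using assms(2,3) by (simp only: complex_norm_square mult_1_right)
  hence "(cmod k)\<^sup>2 = 1" by (simp only: of_real_eq_1_iff)
  thus ?thesis using norm_ge_zero[of k] by (simp only: uv power2_eq_1_iff) linarith
qed

lemma inj_dilation: "inj dilation"
  by (auto simp: inj_def dilation_def dest: fun_cong[of _ _ 1])

lemma sum_square_dilation_group:
  "(\<Sum>y\<in>square_dilation_group. g y) = (\<Sum>a\<in>nonzero_squares. g (dilation a))"
  unfolding square_dilation_group_def
  by (subst sum.reindex) (auto intro: inj_on_subset[OF inj_dilation])

lemma card_square_dilation_group:
  "card (square_dilation_group :: ('a::field \<Rightarrow> 'a) set) = card (nonzero_squares :: 'a set)"
  unfolding square_dilation_group_def by (rule card_image) (rule inj_on_subset[OF inj_dilation], simp)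

text \<open>Write \<open>g\<close> as the translation by \<open>b = g 0\<close> after a dilation.
  The dilation only moves the argument of a constant function within the group, and conjugation by
  \<open>dilation a\<close> turns \<open>b\<close> into \<open>b / a\<close>.\<close>

lemma ind_rep_constant:
  fixes \<alpha> :: "('a::field \<Rightarrow> 'a) \<Rightarrow> complex"
  assumes "g \<in> carrier square_affine_group" "a \<in> nonzero_squares"
  shows "ind_rep square_affine_group translation_group square_dilation_group \<alpha> g
      (\<lambda>y. if y \<in> square_dilation_group then c else 0) (dilation a)
    = \<alpha> (translation (g 0 * inverse a)) * c"
proof -
  let ?G = "square_affine_group :: ('a \<Rightarrow> 'a) monoid" and ?K = "square_dilation_group :: ('a \<Rightarrow> 'a) set"
  obtain d b where g: "g = (\<lambda>x. d * x + b)" and d: "d \<in> nonzero_squares"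
    using assms(1) by (auto simp: square_affine_group_def)
  have mult: "h \<otimes>\<^bsub>?G\<^esub> k = h \<circ> k" for h k by (simp add: square_affine_group_def)
  have g': "g = translation b \<otimes>\<^bsub>?G\<^esub> dilation d"
    by (auto simp: g mult translation_def dilation_def)
  have mem: "dilation x \<in> ?K" if "x \<in> nonzero_squares" for x
    using that by (simp add: square_dilation_group_def)
  have "inv\<^bsub>?G\<^esub> dilation d \<otimes>\<^bsub>?G\<^esub> dilation a = dilation (inverse d * a)"
    unfolding inv_dilation[OF d] mult by (auto simp: dilation_def)
  hence "inv\<^bsub>?G\<^esub> dilation d \<otimes>\<^bsub>?G\<^esub> dilation a \<in> ?K"
    using mem d assms(2) by (simp add: nonzero_squares_closed)
  moreover have "inv\<^bsub>?G\<^esub> dilation a \<otimes>\<^bsub>?G\<^esub> translation b \<otimes>\<^bsub>?G\<^esub> dilation a = translation (b * inverse a)"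
    unfolding inv_dilation[OF assms(2)] mult using nonzero_squares_closed(4)[OF assms(2)]
    by (auto simp: dilation_def translation_def fun_eq_iff field_simps)
  ultimately show ?thesis
    unfolding g' using mem d assms(2)
    by (subst ind_rep_mult[OF semidirect_square_affine_group])
      (auto simp: translation_group_def mult translation_def dilation_def)
qed

theorem proposition1:
  fixes p r q :: nat
    and G :: "('a::finite_field \<Rightarrow> 'a) monoid"
    and H K :: "('a \<Rightarrow> 'a) set"
    and \<alpha>\<^sub>1 :: "('a \<Rightarrow> 'a) \<Rightarrow> complex"
    and f :: "('a \<Rightarrow> 'a) \<Rightarrow> complex"
    and \<Phi> :: "('a \<Rightarrow> 'a) \<Rightarrow> ('a \<Rightarrow> 'a) \<Rightarrow> complex"
  assumes "prime p" and "q = p ^ r" and "q > 3" and "q mod 4 = 3"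
    and "CARD('a) = q"
    and "G = square_affine_group" and "H = translation_group" and "K = square_dilation_group"
    and "\<alpha>\<^sub>1 = trace_char p r"
    and "f = (\<lambda>y. if y \<in> K then complex_of_real (sqrt (2 / (real q - 1))) else 0)"
    and "\<Phi> = (\<lambda>x. ind_rep G H K \<alpha>\<^sub>1 x f)"
  shows "(\<forall>J. projective_reduction (carrier G) \<Phi> J \<longrightarrow>
            equiangular_tight_frame K J \<Phi> \<and> card J = q) \<and>
         real (cfun.dim (L2 K)) = (real q - 1) / 2"
proof -
  define \<psi> where "\<psi> = (\<lambda>c::'a. trace_char p r (translation c))"
  interpret \<psi>: additive_character \<psi>
    unfolding \<psi>_def using assms by (intro additive_character_trace_char) auto
  let ?Q = "nonzero_squares :: 'a set"
  \<comment> \<open>\<open>n\<close> is the dimension and \<open>s\<close> the value of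
    \<open>f\<close>; \<open>s\<^sup>2 = 1 / n\<close> normalizes the vectors.\<close>
  define n where "n = (real q - 1) / 2"
  define s where "s = sqrt (2 / (real q - 1))"
  have q4: "CARD('a) mod 4 = 3" using assms by simp
  have n: "n > 1" using assms(3) by (simp add: n_def)
  have s2: "s\<^sup>2 = 1 / n" using assms(3) by (simp add: s_def n_def)
  have cardQ: "real (card ?Q) = n"
  proof -
    have "q - 1 = 2 * card ?Q"
      using card_nonzero_squares[OF q4] assms(4,5) by presburger
    thus ?thesis using assms(3) by (simp add: n_def)
  qed
  have finK: "finite K" by (simp add: assms(8) square_dilation_group_def)
  have \<Phi>_dil: "\<Phi> x (dilation a) = \<psi> (x 0 * inverse a) * s" if "x \<in> carrier G" "a \<in> ?Q" for x a
    using ind_rep_constant[of x a "\<alpha>\<^sub>1" s] that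
    by (simp only: assms(6-8,10,11) \<psi>_def s_def flip: assms(9))
  have inner_g: "l2_inner K g (\<Phi> x)
      = s * (\<Sum>a\<in>?Q. g (dilation a) * cnj (\<psi> (x 0 * inverse a)))" if "x \<in> carrier G" for g x
    unfolding l2_inner_def assms(8) sum_square_dilation_group sum_distrib_left
    by (intro sum.cong refl) (use that in \<open>simp add: \<Phi>_dil\<close>)
  have inner: "l2_inner K (\<Phi> x) (\<Phi> y) = \<psi>.square_sum (x 0 - y 0) / n"
    if "x \<in> carrier G" "y \<in> carrier G" for x y
  proof -
    have "l2_inner K (\<Phi> x) (\<Phi> y)
        = s\<^sup>2 * (\<Sum>a\<in>?Q. \<psi> (x 0 * inverse a) * cnj (\<psi> (y 0 * inverse a)))"
      unfolding inner_g[OF that(2)] using that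
      by (simp add: \<Phi>_dil sum_distrib_left power2_eq_square mult_ac)
    also have "(\<Sum>a\<in>?Q. \<psi> (x 0 * inverse a) * cnj (\<psi> (y 0 * inverse a)))
        = (\<Sum>a\<in>?Q. \<psi> ((x 0 - y 0) * inverse a))"
      by (intro sum.cong refl) (simp add: \<psi>.cnj_eq left_diff_distrib flip: \<psi>.add)
    \<comment> \<open>Inversion permutes the nonzero squares.\<close>
    also have "\<dots> = \<psi>.square_sum (x 0 - y 0)"
      unfolding \<psi>.square_sum_def
      by (rule sum.reindex_bij_witness[of _ inverse inverse]) (auto simp: nonzero_squares_closed)
    finally show ?thesis by (simp add: s2)
  qed
  have inner_self: "l2_inner K (\<Phi> x) (\<Phi> y) = 1"
    if "x \<in> carrier G" "y \<in> carrier G" "x 0 = y 0" for x y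
  proof -
    have "\<psi>.square_sum 0 = of_real n"
      by (simp only: \<psi>.square_sum_zero of_real_of_nat_eq flip: cardQ)
    thus ?thesis using inner[OF that(1,2)] that(3) n by simp
  qed
  define C where "C = cmod (\<psi>.square_sum 1) / n"
  have inner_C: "cmod (l2_inner K (\<Phi> x) (\<Phi> y)) = C"
    if "x \<in> carrier G" "y \<in> carrier G" "x 0 \<noteq> y 0" for x y
    using inner[OF that(1,2)] that(3) n \<psi>.norm_square_sum_eq[OF q4, of "x 0 - y 0"]
    by (simp add: C_def norm_divide)
  \<comment> \<open>Equality would mean \<open>(q - 1)\<^sup>2 = q + 1\<close>, that is
    \<open>q * (q - 3) = 0\<close>. At \<open>q = 3\<close> the space is one-dimensional and all
    lines coincide.\<close>
  have "C \<noteq> 1"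
  proof
    assume "C = 1"
    hence "n\<^sup>2 = (real q + 1) / 4"
      using \<psi>.norm_square_sum[OF q4, of 1] n by (simp add: C_def assms(5))
    hence "real q * (real q - 3) = 0" by (simp add: n_def power2_eq_square field_simps)
    thus False using assms(3) by simp
  qed
  have line: "x 0 = y 0"
    if "x \<in> carrier G" "y \<in> carrier G" "cfun.span {\<Phi> x} = cfun.span {\<Phi> y}" for x y
    using unit_vectors_same_line[OF that(3)] inner_self inner_C[of x y] that \<open>C \<noteq> 1\<close> by metis
  have \<Phi>_eq: "\<Phi> x = \<Phi> y" if "x \<in> carrier G" "y \<in> carrier G" "x 0 = y 0" for x y
  proof
    fix k
    show "\<Phi> x k = \<Phi> y k"
    proof (cases "k \<in> K")
      case True
      then obtain a where "a \<in> ?Q" "k = dilation a"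
        by (auto simp: assms(8) square_dilation_group_def)
      thus ?thesis using that by (simp add: \<Phi>_dil)
    next
      case False
      thus ?thesis using ind_rep_in_L2[of G H K "\<alpha>\<^sub>1" _ f] by (simp add: assms(11) L2_def)
    qed
  qed
  have "equiangular_tight_frame K J \<Phi> \<and> card J = q" if J: "projective_reduction (carrier G) \<Phi> J" for J
  proof -
    have JG: "J \<subseteq> carrier G"
      and J1: "\<And>i. i \<in> carrier G \<Longrightarrow> \<exists>!j. j \<in> J \<and> cfun.span {\<Phi> j} = cfun.span {\<Phi> i}"
      using J by (auto simp: projective_reduction_def)
    \<comment> \<open>Equal values at 0 give equal vectors, hence one line, which has a single
      representative in \<open>J\<close>.\<close>
    have inj: "inj_on (\<lambda>x. x 0) J"
    proof (rule inj_onI)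
      fix x y assume "x \<in> J" "y \<in> J" "x 0 = y 0"
      thus "x = y" using JG J1[of x] \<Phi>_eq[of x y] by (metis subsetD)
    qed
    \<comment> \<open>The representative of the line of \<open>translation b\<close> must itself
      send 0 to \<open>b\<close>, since distinct values give distinct lines.\<close>
    have "b \<in> (\<lambda>x. x 0) ` J" for b
    proof -
      have b: "translation b \<in> carrier G" using affine_in_carrier(2) by (simp add: assms(6))
      then obtain j where "j \<in> J" "cfun.span {\<Phi> j} = cfun.span {\<Phi> (translation b)}"
        using J1 by blast
      moreover from this have "j 0 = translation b 0" using JG b by (intro line) auto
      ultimately show ?thesis by (auto simp: translation_def)
    qed
    hence bij: "bij_betw (\<lambda>x. x 0) J UNIV" using inj by (auto simp: bij_betw_def)
    have card: "card J = q" using bij_betw_same_card[OF bij] assms(5) by simp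
    have eq: "equiangular K J \<Phi>"
      unfolding equiangular_def
    proof (intro exI[of _ C] ballI)
      fix i j assume ij: "i \<in> J" "j \<in> J"
      show "cmod (l2_inner K (\<Phi> i) (\<Phi> j)) = (if i = j then 1 else C)"
        using ij JG inner_self[of i j] inner_C[of i j] inj_onD[OF inj, of i j] by auto
    qed
    \<comment> \<open>Evaluation at 0 turns the sum over \<open>J\<close> into one over the whole
      field. The resulting frame bound is the number of vectors divided by the dimension.\<close>
    have parseval: "(\<Sum>j\<in>J. (cmod (l2_inner K g (\<Phi> j)))\<^sup>2) = q / n * (l2_norm K g)\<^sup>2" for g
    proof -
      have "(\<Sum>j\<in>J. (cmod (l2_inner K g (\<Phi> j)))\<^sup>2)
          = (\<Sum>j\<in>J. s\<^sup>2 * (cmod (\<Sum>a\<in>?Q. g (dilation a) * cnj (\<psi> (j 0 * inverse a))))\<^sup>2)"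
        using JG by (intro sum.cong refl) (auto simp: inner_g norm_mult power_mult_distrib)
      also have "\<dots> = (\<Sum>b\<in>UNIV. s\<^sup>2 * (cmod (\<Sum>a\<in>?Q. g (dilation a) * cnj (\<psi> (b * inverse a))))\<^sup>2)"
        by (rule sum.reindex_bij_betw[OF bij])
      also have "\<dots> = s\<^sup>2 * (q * (\<Sum>a\<in>?Q. (cmod (g (dilation a)))\<^sup>2))"
        unfolding sum_distrib_left[symmetric] by (subst \<psi>.parseval) (auto simp: inj_on_def assms(5))
      also have "(\<Sum>a\<in>?Q. (cmod (g (dilation a)))\<^sup>2) = (l2_norm K g)\<^sup>2"
        by (simp add: l2_norm_def l2_inner_def assms(8) sum_square_dilation_group
            sum_nonneg flip: complex_norm_square)
      finally show ?thesis by (simp add: s2)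
    qed
    have "finite J" using card assms(3) by (simp add: card_ge_0_finite)
    moreover have "\<Phi> j \<in> L2 K" for j by (simp add: assms(11) ind_rep_in_L2)
    ultimately have "frame_with_bounds K J \<Phi> (q / n) (q / n)"
      using n assms(3) by (simp add: frame_with_bounds_def parseval)
    thus ?thesis using eq card by (auto simp: equiangular_tight_frame_def tight_frame_def)
  qed
  moreover have "real (cfun.dim (L2 K)) = (real q - 1) / 2"
    using dim_L2[OF finK] cardQ by (simp add: assms(8) card_square_dilation_group n_def)
  ultimately show ?thesis by blast
qed

end
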